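(* Suppose that the $m$-stage Runge--Kutta method satisfies Assumption (P5) (stated in the context), and apply the lumped mass finite element method with $r=1$ in space. Then the cut-off SAV Runge--Kutta scheme described in the context satisfies the energy decay property $$\frac12\|\nabla u_h^n\|_{L^2(\Omega)}^2+|z^n|^2\le\frac12\|\nabla u_h^{n-1}\|_{L^2(\Omega)}^2+|z^{n-1}|^2\qquad\text{for all } n\ge k.$$ Meanwhile, the fully discrete solution satisfies the maximum bound principle $$\max_{k\le n\le N}|u_h^n(x)|\le\alpha\qquad\text{for all }x\in\Omega.$$
   Context: Allen--Cahn equation: $\Omega=[a,b]$, $T>0$; $u_t=\Delta u+f(u)$ in $\Omega\times(0,T)$, $u(\cdot,0)=u_0$, with homogeneous Neumann boundary condition, where $f=-F'$ and $F$ is a double-well potential with two wells at $\pm\alpha$, $\alpha>0$ known. Set $E_1(v)=\int_\Omega F(v(x))\,dx$, assumed globally bounded from below, $E_1(v)>-C_0$, and $W(v)=f(v)/\sqrt{E_1(v)+C_0}$. Space discretization ($r=1$): uniform partition $a=x_0<x_1<\dots<x_M=b$ with mesh size $h=(b-a)/M$; $S_h=S_h^1$ is the space of functions in $H^1(\Omega)$ that are affine on each $[x_{i-1},x_i]$. $(f,g)_h=\sum_{i=1}^M\frac h2\big(f(x_{i-1})g(x_{i-1})+f(x_i)g(x_i)\big)$ (piecewise two-point Gauss--Lobatto quadrature). $\Pi_h:C(\overline\Omega)\to S_h$ is nodal Lagrange interpolation. The discrete Laplacian $-\Delta_h:S_h\to S_h$ is defined by $(-\Delta_hv_h,w_h)_h=(\nabla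 v_h,\nabla w_h)$ for all $v_h,w_h\in S_h$, with $(\cdot,\cdot)$ the $L^2(\Omega)$ inner product. Time grid and Runge--Kutta method: $\tau=T/N$, $t_n=n\tau$. The method has coefficients $A=(a_{ij})_{i,j=1}^m$, weights $b_i$ and distinct quadrature points $c_i$, and is of collocation type: $\sum_{i=1}^mb_ic_i^{l-1}=\frac1l$ for $l=1,\dots,p$ and $\sum_{j=1}^ma_{ij}c_j^{l-1}=\frac{c_i^l}{l}$ for $l=1,\dots,m$, with some integer $p\ge m$; $k=\min(p,m+1)$. For given $n\ge k$, $L_\ell$, $\ell=1,\dots,k$, are the Lagrange basis polynomials of degree $k-1$ in time with $L_\ell(t_{n-i})=\delta_{i\ell}$. Assumption (P5) (algebraic stability): (a) the matrix $A=(a_{ij})$ is invertible; (b) $b_i>0$ for $i=1,\dots,m$; (c) the symmetric matrix $\mathcal M\in\mathbb{R}^{m\times m}$ with entries $m_{ij}=b_ia_{ij}+b_ja_{ji}-b_ib_j$ is positive semidefinite. Cut-off SAV Runge--Kutta scheme: for $n\ge k$, given $u_h^{n-k},\dots,u_h^{n-1}\in S_h$ and $z^{n-1}\in\mathbb{R}$, set $W_h^{ni}=\sum_{\ell=1}^kL_\ell(t_{n-1}+c_i\tau)\Pi_hW(u_h^{n-\ell})$ and find $\hat u_h^n\in S_h$, $z^n\in\mathbb{R}$ such that, for $i=1,\dots,m$, $$\dot u_h^{ni}=\Delta_hu_h^{ni}+z^{ni}W_h^{ni},\quad u_h^{ni}=u_h^{n-1}+\tau\sum_{j=1}^ma_{ij}\dot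 u_h^{nj},\quad \hat u_h^n=u_h^{n-1}+\tau\sum_{i=1}^mb_i\dot u_h^{ni},$$ $$\dot z^{ni}=-\tfrac12(W_h^{ni},\dot u_h^{ni})_h,\quad z^{ni}=z^{n-1}+\tau\sum_{j=1}^ma_{ij}\dot z^{nj},\quad z^n=z^{n-1}+\tau\sum_{i=1}^mb_i\dot z^{ni}.$$ Then $u_h^n\in S_h$ is defined by $u_h^n(x_j)=\min(\max(\hat u_h^n(x_j),-\alpha),\alpha)$, $j=0,\dots,M$. *)

theory Defs
  imports "HOL-Analysis.Analysis"
begin

section \<open>The spaces $L^2(a,b)$ and $H^1(a,b)$\<close>

definition L2_space :: "real \<Rightarrow> real \<Rightarrow> (real \<Rightarrow> real) set" where
  "L2_space a b = {g \<in> borel_measurable (lebesgue_on {a..b}).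
     integrable (lebesgue_on {a..b}) (\<lambda>x. (g x)\<^sup>2)}"

definition L2_inner :: "real \<Rightarrow> real \<Rightarrow> (real \<Rightarrow> real) \<Rightarrow> (real \<Rightarrow> real) \<Rightarrow> real" where
  "L2_inner a b f g = (LINT x|lebesgue_on {a..b}. f x * g x)"

definition L2_norm :: "real \<Rightarrow> real \<Rightarrow> (real \<Rightarrow> real) \<Rightarrow> real" where
  "L2_norm a b g = sqrt (L2_inner a b g g)"

definition test_function :: "real \<Rightarrow> real \<Rightarrow> (real \<Rightarrow> real) \<Rightarrow> bool" where
  "test_function a b \<phi> \<longleftrightarrow>
     (\<forall>j x. (deriv ^^ j) \<phi> differentiable (at x)) \<and> closure {x. \<phi> x \<noteq> 0} \<subseteq> {a<..<b}"

definition weak_derivative :: "real \<Rightarrow> real \<Rightarrow> (real \<Rightarrow> real) \<Rightarrow> (real \<Rightarrow> real) \<Rightarrow> bool" where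
  "weak_derivative a b v g \<longleftrightarrow>
     (\<forall>\<phi>. test_function a b \<phi> \<longrightarrow> L2_inner a b v (deriv \<phi>) = - L2_inner a b g \<phi>)"

definition H1_space :: "real \<Rightarrow> real \<Rightarrow> (real \<Rightarrow> real) set" where
  "H1_space a b = {v \<in> L2_space a b. \<exists>g \<in> L2_space a b. weak_derivative a b v g}"


section \<open>Piecewise linear finite elements with mass lumping\<close>

definition node :: "real \<Rightarrow> real \<Rightarrow> nat \<Rightarrow> nat \<Rightarrow> real" where
  "node a b M i = a + real i * ((b - a) / real M)"

text \<open>Functions on $[a,b]$ are represented by functions on the real line. Elements of \<open>Sh\<close> are
  extended by 0, so that equality in \<open>Sh\<close> is equality of functions and \<open>Sh\<close> is a linear space.
  Affinity is required on the closed cells, which fixes the continuous representative.\<close>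

definition Sh :: "real \<Rightarrow> real \<Rightarrow> nat \<Rightarrow> (real \<Rightarrow> real) set" where
  "Sh a b M = {v \<in> H1_space a b.
     (\<forall>i<M. \<exists>p q. \<forall>x\<in>{node a b M i..node a b M (Suc i)}. v x = p * x + q) \<and>
     (\<forall>x. x \<notin> {a..b} \<longrightarrow> v x = 0)}"

text \<open>For \<open>v\<close> in \<open>Sh\<close> the gradient is the classical derivative, which exists off the nodes; its
  values at the nodes are irrelevant. It is the weak derivative: see \<open>Sh_weak_derivative\<close>.\<close>

abbreviation grad :: "(real \<Rightarrow> real) \<Rightarrow> real \<Rightarrow> real" where
  "grad v \<equiv> deriv v"

definition lumped_inner ::
    "real \<Rightarrow> real \<Rightarrow> nat \<Rightarrow> (real \<Rightarrow> real) \<Rightarrow> (real \<Rightarrow> real) \<Rightarrow> real" where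
  "lumped_inner a b M f g = (\<Sum>i=1..M. ((b - a) / real M) / 2 *
     (f (node a b M (i - 1)) * g (node a b M (i - 1)) + f (node a b M i) * g (node a b M i)))"

text \<open>The unique existence behind the two definite descriptions below is proved in
  \<open>interp_ex1\<close> and \<open>disc_laplacian_ex1\<close>.\<close>

definition interp :: "real \<Rightarrow> real \<Rightarrow> nat \<Rightarrow> (real \<Rightarrow> real) \<Rightarrow> real \<Rightarrow> real" where
  "interp a b M g = (THE v. v \<in> Sh a b M \<and> (\<forall>i\<le>M. v (node a b M i) = g (node a b M i)))"

definition disc_laplacian :: "real \<Rightarrow> real \<Rightarrow> nat \<Rightarrow> (real \<Rightarrow> real) \<Rightarrow> real \<Rightarrow> real" where
  "disc_laplacian a b M v = (THE q. q \<in> Sh a b M \<and>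
     (\<forall>w\<in>Sh a b M. lumped_inner a b M (\<lambda>x. - q x) w = L2_inner a b (grad v) (grad w)))"


section \<open>The nonlinearity\<close>

text \<open>The two wells are the two local minimum points.\<close>

definition double_well :: "(real \<Rightarrow> real) \<Rightarrow> real \<Rightarrow> bool" where
  "double_well F \<alpha> \<longleftrightarrow> (\<forall>s. F differentiable (at s)) \<and>
     {s. \<exists>e>0. \<forall>y. \<bar>y - s\<bar> < e \<longrightarrow> F s \<le> F y} = {-\<alpha>, \<alpha>}"

definition reaction :: "(real \<Rightarrow> real) \<Rightarrow> real \<Rightarrow> real" where
  "reaction F s = - deriv F s"

definition E1 :: "real \<Rightarrow> real \<Rightarrow> (real \<Rightarrow> real) \<Rightarrow> (real \<Rightarrow> real) \<Rightarrow> real" where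
  "E1 a b F v = (LINT x|lebesgue_on {a..b}. F (v x))"

definition W :: "real \<Rightarrow> real \<Rightarrow> (real \<Rightarrow> real) \<Rightarrow> real \<Rightarrow> (real \<Rightarrow> real) \<Rightarrow> real \<Rightarrow> real" where
  "W a b F C0 v x = reaction F (v x) / sqrt (E1 a b F v + C0)"


section \<open>Runge--Kutta methods and the cut-off SAV scheme\<close>

text \<open>Stages are indexed by the finite type \<open>'m\<close>.\<close>

definition rk_collocation :: "real^'m^'m \<Rightarrow> real^'m \<Rightarrow> real^'m \<Rightarrow> nat \<Rightarrow> bool" where
  "rk_collocation A bs cs p \<longleftrightarrow>
     inj (\<lambda>i. cs $ i) \<and> CARD('m) \<le> p \<and>
     (\<forall>l\<in>{1..p}. (\<Sum>i\<in>UNIV. bs $ i * (cs $ i) ^ (l - 1)) = 1 / real l) \<and>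
     (\<forall>l\<in>{1..CARD('m)}. \<forall>i. (\<Sum>j\<in>UNIV. A $ i $ j * (cs $ j) ^ (l - 1)) = (cs $ i) ^ l / real l)"

definition stability_matrix :: "real^'m^'m \<Rightarrow> real^'m \<Rightarrow> real^'m^'m" where
  "stability_matrix A bs = (\<chi> i j. bs $ i * A $ i $ j + bs $ j * A $ j $ i - bs $ i * bs $ j)"

definition pos_semidef :: "real^'m^'m \<Rightarrow> bool" where
  "pos_semidef Q \<longleftrightarrow> transpose Q = Q \<and> (\<forall>x. 0 \<le> x \<bullet> (Q *v x))"

definition algebraically_stable :: "real^'m^'m \<Rightarrow> real^'m \<Rightarrow> bool" where
  "algebraically_stable A bs \<longleftrightarrow>
     invertible A \<and> (\<forall>i. 0 < bs $ i) \<and> pos_semidef (stability_matrix A bs)"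

text \<open>The Lagrange basis polynomial in time for the points $t_{n-1},\dots,t_{n-k}$,
  $t_j=j\tau$, that is 1 at $t_{n-l}$.\<close>

definition lagrange_time :: "real \<Rightarrow> nat \<Rightarrow> nat \<Rightarrow> nat \<Rightarrow> real \<Rightarrow> real" where
  "lagrange_time \<tau> k n l t = (\<Prod>i\<in>{1..k} - {l}.
     (t - real (n - i) * \<tau>) / (real (n - l) * \<tau> - real (n - i) * \<tau>))"

definition extrapolated_W :: "real \<Rightarrow> real \<Rightarrow> nat \<Rightarrow> (real \<Rightarrow> real) \<Rightarrow> real \<Rightarrow> real \<Rightarrow> nat \<Rightarrow> real^'m \<Rightarrow>
    (nat \<Rightarrow> real \<Rightarrow> real) \<Rightarrow> nat \<Rightarrow> 'm \<Rightarrow> real \<Rightarrow> real" where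
  "extrapolated_W a b M F C0 \<tau> k cs u n i x =
     (\<Sum>l=1..k. lagrange_time \<tau> k n l (real (n - 1) * \<tau> + cs $ i * \<tau>) *
        interp a b M (W a b F C0 (u (n - l))) x)"

text \<open>\<open>cutoff_sav_rk_step \<dots> u z n\<close>: the values \<open>u n\<close>, \<open>z n\<close> result from one step of the scheme.
  Here \<open>U i\<close>, \<open>dU i\<close>, \<open>Z i\<close>, \<open>dZ i\<close> are the stage values $u_h^{ni}$, $\dot u_h^{ni}$, $z^{ni}$,
  $\dot z^{ni}$, and \<open>uhat\<close> is the solution before the cut-off.\<close>

definition cutoff_sav_rk_step :: "real \<Rightarrow> real \<Rightarrow> nat \<Rightarrow> (real \<Rightarrow> real) \<Rightarrow> real \<Rightarrow> real \<Rightarrow> real \<Rightarrow> nat \<Rightarrow>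
    real^'m^'m \<Rightarrow> real^'m \<Rightarrow> real^'m \<Rightarrow> (nat \<Rightarrow> real \<Rightarrow> real) \<Rightarrow> (nat \<Rightarrow> real) \<Rightarrow> nat \<Rightarrow> bool" where
  "cutoff_sav_rk_step a b M F C0 \<alpha> \<tau> k A bs cs u z n \<longleftrightarrow>
    (\<exists>(U :: 'm \<Rightarrow> real \<Rightarrow> real) dU (Z :: 'm \<Rightarrow> real) dZ uhat.
      (\<forall>i. U i \<in> Sh a b M \<and> dU i \<in> Sh a b M) \<and> uhat \<in> Sh a b M \<and>
      (\<forall>i x. dU i x = disc_laplacian a b M (U i) x
                       + Z i * extrapolated_W a b M F C0 \<tau> k cs u n i x) \<and>
      (\<forall>i x. U i x = u (n - 1) x + \<tau> * (\<Sum>j\<in>UNIV. A $ i $ j * dU j x)) \<and>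
      (\<forall>x. uhat x = u (n - 1) x + \<tau> * (\<Sum>i\<in>UNIV. bs $ i * dU i x)) \<and>
      (\<forall>i. dZ i = - 1/2 * lumped_inner a b M (extrapolated_W a b M F C0 \<tau> k cs u n i) (dU i)) \<and>
      (\<forall>i. Z i = z (n - 1) + \<tau> * (\<Sum>j\<in>UNIV. A $ i $ j * dZ j)) \<and>
      z n = z (n - 1) + \<tau> * (\<Sum>i\<in>UNIV. bs $ i * dZ i) \<and>
      u n \<in> Sh a b M \<and>
      (\<forall>j\<le>M. u n (node a b M j) = min (max (uhat (node a b M j)) (- \<alpha>)) \<alpha>))"


section \<open>Well-definedness of the finite element notions\<close>

definition pw_affine :: "real \<Rightarrow> real \<Rightarrow> nat \<Rightarrow> (real \<Rightarrow> real) \<Rightarrow> bool" where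
  "pw_affine a b M v \<longleftrightarrow>
     (\<forall>i<M. \<exists>p q. \<forall>x\<in>{node a b M i..node a b M (Suc i)}. v x = p * x + q)"

context
  fixes a b :: real and M :: nat
  assumes ab: "a < b" and M: "1 \<le> M"
begin

lemma node_0: "node a b M 0 = a" and node_M: "node a b M M = b"
  using M by (auto simp: node_def)

lemma node_less_iff: "node a b M i < node a b M j \<longleftrightarrow> i < j"
proof -
  have h: "(b - a) / real M > 0" using ab M by simp
  have "node a b M i < node a b M j \<longleftrightarrow> real i * ((b - a) / real M) < real j * ((b - a) / real M)"
    by (simp add: node_def)
  also have "\<dots> \<longleftrightarrow> real i < real j" using h by (rule mult_less_cancel_right_pos)
  finally show ?thesis by simp
qed

lemma node_le_iff: "node a b M i \<le> node a b M j \<longleftrightarrow> i \<le> j"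
  using node_less_iff[of j i] by linarith

lemma node_in: "i \<le> M \<Longrightarrow> node a b M i \<in> {a..b}"
  using node_le_iff[of 0 i] node_le_iff[of i M] by (simp add: node_0 node_M)

lemma cell_exists:
  assumes "x \<in> {a..b}"
  shows "\<exists>i<M. x \<in> {node a b M i..node a b M (Suc i)}"
proof -
  have "n \<le> M \<Longrightarrow> 1 \<le> n \<Longrightarrow> x \<in> {a..node a b M n} \<Longrightarrow>
      \<exists>i<n. x \<in> {node a b M i..node a b M (Suc i)}" for n
  proof (induction n)
    case (Suc n)
    show ?case
    proof (cases "x \<le> node a b M n \<and> 1 \<le> n")
      case True
      then obtain i where "i < n" "x \<in> {node a b M i..node a b M (Suc i)}"
        using Suc.IH Suc.prems by fastforce
      then show ?thesis by (meson less_SucI)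
    next
      case False
      then have "node a b M n \<le> x"
        using Suc.prems(3) node_0 by (cases "n = 0") auto
      then have "x \<in> {node a b M n..node a b M (Suc n)}" using Suc.prems(3) by simp
      then show ?thesis by blast
    qed
  qed simp
  from this[of M] show ?thesis using assms M by (simp add: node_M)
qed

lemma cells_Union: "{a..b} = (\<Union>i<M. {node a b M i..node a b M (Suc i)})"
proof
  show "{a..b} \<subseteq> (\<Union>i<M. {node a b M i..node a b M (Suc i)})" using cell_exists by blast
  show "(\<Union>i<M. {node a b M i..node a b M (Suc i)}) \<subseteq> {a..b}"
  proof
    fix x assume "x \<in> (\<Union>i<M. {node a b M i..node a b M (Suc i)})"
    then obtain i where "i < M" "x \<in> {node a b M i..node a b M (Suc i)}" by blast
    then show "x \<in> {a..b}" using node_in[of i] node_in[of "Suc i"] by auto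
  qed
qed

lemma open_cell_exists:
  assumes "x \<in> {a..b}" "x \<notin> node a b M ` {..M}"
  shows "\<exists>i<M. x \<in> {node a b M i<..<node a b M (Suc i)}"
proof -
  obtain i where i: "i < M" "x \<in> {node a b M i..node a b M (Suc i)}"
    using cell_exists[OF assms(1)] by blast
  moreover have "x \<noteq> node a b M i" "x \<noteq> node a b M (Suc i)" using assms(2) i(1) by auto
  ultimately show ?thesis by (intro exI[of _ i]) auto
qed

lemma open_cell_unique:
  assumes "x \<in> {node a b M i<..<node a b M (Suc i)}" "x \<in> {node a b M j<..<node a b M (Suc j)}"
  shows "i = j"
proof -
  have "node a b M i < node a b M (Suc j)" "node a b M j < node a b M (Suc i)" using assms by auto
  then show ?thesis by (simp add: node_less_iff)
qed

lemma pw_affine_continuous: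
  assumes "pw_affine a b M v"
  shows "continuous_on {a..b} v"
  unfolding cells_Union
proof (rule continuous_on_closed_Union)
  fix i assume "i \<in> {..<M}"
  then obtain p q where "\<forall>x\<in>{node a b M i..node a b M (Suc i)}. v x = p * x + q"
    using assms unfolding pw_affine_def by blast
  then have e: "continuous_on {node a b M i..node a b M (Suc i)} v \<longleftrightarrow>
      continuous_on {node a b M i..node a b M (Suc i)} (\<lambda>x. p * x + q)"
    by (intro continuous_on_cong) auto
  show "continuous_on {node a b M i..node a b M (Suc i)} v"
    unfolding e by (intro continuous_intros)
qed auto

lemma pw_affine_deriv:
  assumes "pw_affine a b M v"
  obtains P where "\<And>i x. i < M \<Longrightarrow> x \<in> {node a b M i<..<node a b M (Suc i)} \<Longrightarrow>
    (v has_real_derivative P i) (at x)"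
proof -
  obtain P Q where PQ: "\<And>i x. i < M \<Longrightarrow> x \<in> {node a b M i..node a b M (Suc i)} \<Longrightarrow> v x = P i * x + Q i"
    using assms unfolding pw_affine_def by metis
  show thesis
  proof (rule that)
    fix i x assume ix: "i < M" "x \<in> {node a b M i<..<node a b M (Suc i)}"
    have "((\<lambda>x. P i * x + Q i) has_real_derivative P i) (at x)"
      by (auto intro!: derivative_eq_intros)
    then show "(v has_real_derivative P i) (at x)"
      by (rule has_field_derivative_transform_within_open[where S="{node a b M i<..<node a b M (Suc i)}"])
        (use ix PQ[of i] in auto)
  qed
qed

lemma pw_affine_deriv_at:
  assumes "pw_affine a b M v" "x \<in> {a..b}" "x \<notin> node a b M ` {..M}"
  shows "(v has_real_derivative deriv v x) (at x)"
proof -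
  obtain P where P: "\<And>i x. i < M \<Longrightarrow> x \<in> {node a b M i<..<node a b M (Suc i)} \<Longrightarrow>
    (v has_real_derivative P i) (at x)" using pw_affine_deriv[OF assms(1)] by blast
  obtain i where "i < M" "x \<in> {node a b M i<..<node a b M (Suc i)}"
    using open_cell_exists[OF assms(2,3)] by blast
  from P[OF this] show ?thesis using DERIV_imp_deriv by metis
qed

lemma pw_affine_deriv_bounded:
  assumes "pw_affine a b M v"
  shows "\<exists>B. \<forall>x\<in>{a..b}. \<bar>deriv v x\<bar> \<le> B"
proof -
  obtain P where P: "\<And>i x. i < M \<Longrightarrow> x \<in> {node a b M i<..<node a b M (Suc i)} \<Longrightarrow>
    (v has_real_derivative P i) (at x)" using pw_affine_deriv[OF assms] by blast
  have "deriv v ` {a..b} \<subseteq> P ` {..<M} \<union> deriv v ` node a b M ` {..M}"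
  proof
    fix y assume "y \<in> deriv v ` {a..b}"
    then obtain x where x: "x \<in> {a..b}" "y = deriv v x" by blast
    show "y \<in> P ` {..<M} \<union> deriv v ` node a b M ` {..M}"
    proof (cases "x \<in> node a b M ` {..M}")
      case False
      then obtain i where "i < M" "x \<in> {node a b M i<..<node a b M (Suc i)}"
        using open_cell_exists[OF x(1)] by blast
      then show ?thesis using P x(2) DERIV_imp_deriv by blast
    qed (use x in blast)
  qed
  then have "finite (deriv v ` {a..b})" by (rule finite_subset) auto
  then have "bounded (deriv v ` {a..b})" by (rule finite_imp_bounded)
  then show ?thesis unfolding bounded_iff by auto
qed

lemma pw_affine_deriv_measurable:
  assumes "pw_affine a b M v"
  shows "deriv v \<in> borel_measurable (lebesgue_on {a..b})"
proof -
  obtain P where P: "\<And>i x. i < M \<Longrightarrow> x \<in> {node a b M i<..<node a b M (Suc i)} \<Longrightarrow>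
    (v has_real_derivative P i) (at x)" using pw_affine_deriv[OF assms] by blast
  define g where "g x = (\<Sum>i<M. P i * indicator {node a b M i<..<node a b M (Suc i)} x)" for x :: real
  have "g \<in> borel_measurable borel" unfolding g_def by measurable
  then have g: "g \<in> borel_measurable (lebesgue_on {a..b})"
    using measurable_restrict_space1 measurable_completion measurable_lborel2 by blast
  show ?thesis
  proof (rule measurable_discrete_difference[OF g, where X="node a b M ` {..M}"])
    show "countable (node a b M ` {..M})" by simp
    show "{x} \<in> sets (lebesgue_on {a..b})" if "x \<in> node a b M ` {..M}" for x
      using that node_in by (auto simp: sets_restrict_space_iff)
    fix x assume x: "x \<in> space (lebesgue_on {a..b})" "x \<notin> node a b M ` {..M}"
    then have "x \<in> {a..b}" by (simp add: space_restrict_space)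
    from open_cell_exists[OF this x(2)]
    obtain i where i: "i < M" "x \<in> {node a b M i<..<node a b M (Suc i)}" by blast
    have "g x = (\<Sum>j<M. if j = i then P i else 0)"
      unfolding g_def
    proof (rule sum.cong)
      fix j
      show "P j * indicator {node a b M j<..<node a b M (Suc j)} x = (if j = i then P i else 0)"
      proof (cases "j = i")
        case False
        then have "x \<notin> {node a b M j<..<node a b M (Suc j)}" using open_cell_unique[OF i(2)] by metis
        then have "indicator {node a b M j<..<node a b M (Suc j)} x = (0::real)"
          by (rule indicator_simps(2))
        then show ?thesis using False by simp
      next
        case True
        have "indicator {node a b M i<..<node a b M (Suc i)} x = (1::real)"
          using i(2) by (rule indicator_simps(1))
        then show ?thesis using True by simp
      qed
    qed simp
    also have "\<dots> = P i" using i(1) by simp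
    also have "\<dots> = deriv v x" using DERIV_imp_deriv[OF P[OF i]] by simp
    finally show "g x = deriv v x" .
  qed simp
qed

lemma bounded_integrable:
  fixes f :: "real \<Rightarrow> real"
  assumes "f \<in> borel_measurable (lebesgue_on {a..b})" "\<And>x. x \<in> {a..b} \<Longrightarrow> \<bar>f x\<bar> \<le> B"
  shows "integrable (lebesgue_on {a..b}) f"
proof (rule integrableI_bounded_set[where A="{a..b}" and B=B])
  show "emeasure (lebesgue_on {a..b}) {a..b} < \<infinity>"
    using emeasure_compact_finite[of "{a..b}"] by (simp add: emeasure_restrict_space)
qed (use assms in \<open>auto simp: sets_restrict_space_iff\<close>)

lemma bounded_L2:
  assumes "f \<in> borel_measurable (lebesgue_on {a..b})" "\<And>x. x \<in> {a..b} \<Longrightarrow> \<bar>f x\<bar> \<le> B"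
  shows "f \<in> L2_space a b"
proof -
  have "integrable (lebesgue_on {a..b}) (\<lambda>x. (f x)\<^sup>2)"
  proof (rule bounded_integrable[where B="B\<^sup>2"])
    show "(\<lambda>x. (f x)\<^sup>2) \<in> borel_measurable (lebesgue_on {a..b})" using assms(1) by measurable
    show "\<bar>(f x)\<^sup>2\<bar> \<le> B\<^sup>2" if "x \<in> {a..b}" for x
      using assms(2)[OF that] by (simp add: abs_le_square_iff[symmetric])
  qed
  then show ?thesis using assms(1) by (simp add: L2_space_def)
qed

lemma continuous_measurable_bounded:
  fixes f :: "real \<Rightarrow> real"
  assumes "continuous_on {a..b} f"
  shows "f \<in> borel_measurable (lebesgue_on {a..b})" "\<exists>B. \<forall>x\<in>{a..b}. \<bar>f x\<bar> \<le> B"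
proof -
  show "f \<in> borel_measurable (lebesgue_on {a..b})"
    by (rule continuous_imp_measurable_on_sets_lebesgue[OF assms]) simp
  have "bounded (f ` {a..b})"
    by (intro compact_imp_bounded compact_continuous_image assms compact_Icc)
  then show "\<exists>B. \<forall>x\<in>{a..b}. \<bar>f x\<bar> \<le> B" unfolding bounded_iff by auto
qed

lemma integrable_bounded_mult_continuous:
  fixes f :: "real \<Rightarrow> real"
  assumes "f \<in> borel_measurable (lebesgue_on {a..b})" "\<exists>B. \<forall>x\<in>{a..b}. \<bar>f x\<bar> \<le> B"
    and "g \<in> borel_measurable (lebesgue_on {a..b})" "\<exists>B. \<forall>x\<in>{a..b}. \<bar>g x\<bar> \<le> B"
  shows "integrable (lebesgue_on {a..b}) (\<lambda>x. f x * g x)"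
proof -
  obtain B where B: "\<forall>x\<in>{a..b}. \<bar>f x\<bar> \<le> B" using assms(2) by blast
  obtain C where C: "\<forall>x\<in>{a..b}. \<bar>g x\<bar> \<le> C" using assms(4) by blast
  show ?thesis
  proof (rule bounded_integrable[where B="B * C"])
    show "(\<lambda>x. f x * g x) \<in> borel_measurable (lebesgue_on {a..b})" using assms(1,3) by measurable
    show "\<bar>f x * g x\<bar> \<le> B * C" if "x \<in> {a..b}" for x
    proof -
      have "\<bar>f x\<bar> \<le> B" "\<bar>g x\<bar> \<le> C" using that B C by auto
      then have "\<bar>f x\<bar> * \<bar>g x\<bar> \<le> B * C" by (intro mult_mono) auto
      then show ?thesis by (simp add: abs_mult)
    qed
  qed
qed

lemma pw_affine_weak_derivative:
  assumes v: "pw_affine a b M v"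
  shows "weak_derivative a b v (deriv v)"
  unfolding weak_derivative_def
proof (intro allI impI)
  fix \<phi> assume phi: "test_function a b \<phi>"
  have d0: "\<phi> differentiable (at x)" for x
    using phi unfolding test_function_def by (metis funpow_0)
  have d1: "deriv \<phi> differentiable (at x)" for x
  proof -
    have "(deriv ^^ 1) \<phi> differentiable (at x)" using phi unfolding test_function_def by blast
    then show ?thesis by simp
  qed
  have D: "(\<phi> has_real_derivative deriv \<phi> x) (at x)" for x
    using d0[of x] by (metis DERIV_imp_deriv real_differentiable_def)
  have c0: "continuous_on {a..b} \<phi>" and c1: "continuous_on {a..b} (deriv \<phi>)"
    using d0 d1 by (auto intro!: continuous_at_imp_continuous_on differentiable_imp_continuous_within)
  have supp: "x \<in> {a<..<b}" if "\<phi> x \<noteq> 0" for x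
    using that phi closure_subset[of "{x. \<phi> x \<noteq> 0}"] unfolding test_function_def by blast
  have end0: "\<phi> a = 0" "\<phi> b = 0" using supp[of a] supp[of b] by auto
  have cv: "continuous_on {a..b} v" by (rule pw_affine_continuous[OF v])
  let ?S = "node a b M ` {..M}"
  have hi: "((\<lambda>x. v x * deriv \<phi> x + deriv v x * \<phi> x) has_integral v b * \<phi> b - v a * \<phi> a) {a..b}"
  proof (rule fundamental_theorem_of_calculus_interior_strong[where S="?S"])
    show "continuous_on {a..b} (\<lambda>x. v x * \<phi> x)" using cv c0 by (intro continuous_intros)
    fix x assume "x \<in> {a<..<b} - ?S"
    then have "(v has_real_derivative deriv v x) (at x)" using pw_affine_deriv_at[OF v] by auto
    then have "((\<lambda>x. v x * \<phi> x) has_real_derivative (v x * deriv \<phi> x + deriv v x * \<phi> x)) (at x)"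
      using D[of x] by (auto intro!: derivative_eq_intros)
    then show "((\<lambda>x. v x * \<phi> x) has_vector_derivative (v x * deriv \<phi> x + deriv v x * \<phi> x)) (at x)"
      by (simp add: has_real_derivative_iff_has_vector_derivative)
  qed (use ab in auto)
  have i1: "integrable (lebesgue_on {a..b}) (\<lambda>x. v x * deriv \<phi> x)"
    by (intro integrable_bounded_mult_continuous continuous_measurable_bounded cv c1)
  have i2: "integrable (lebesgue_on {a..b}) (\<lambda>x. deriv v x * \<phi> x)"
    by (intro integrable_bounded_mult_continuous continuous_measurable_bounded c0
        pw_affine_deriv_measurable pw_affine_deriv_bounded v)
  have "L2_inner a b v (deriv \<phi>) + L2_inner a b (deriv v) \<phi> =
      (LINT x|lebesgue_on {a..b}. v x * deriv \<phi> x + deriv v x * \<phi> x)"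
    using i1 i2 by (simp add: L2_inner_def)
  also have "\<dots> = integral {a..b} (\<lambda>x. v x * deriv \<phi> x + deriv v x * \<phi> x)"
    using i1 i2 by (intro lebesgue_integral_eq_integral) auto
  also have "\<dots> = 0" using hi end0 by (simp add: integral_unique)
  finally show "L2_inner a b v (deriv \<phi>) = - L2_inner a b (deriv v) \<phi>" by simp
qed

lemma pw_affine_H1:
  assumes "pw_affine a b M v"
  shows "v \<in> H1_space a b"
proof -
  have "v \<in> L2_space a b"
    using continuous_measurable_bounded[OF pw_affine_continuous[OF assms]] bounded_L2 by blast
  moreover have "deriv v \<in> L2_space a b"
    using pw_affine_deriv_measurable[OF assms] pw_affine_deriv_bounded[OF assms] bounded_L2 by blast
  ultimately show ?thesis
    using pw_affine_weak_derivative[OF assms] unfolding H1_space_def by blast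
qed

lemma Sh_iff: "v \<in> Sh a b M \<longleftrightarrow> pw_affine a b M v \<and> (\<forall>x. x \<notin> {a..b} \<longrightarrow> v x = 0)"
proof -
  have "v \<in> Sh a b M \<longleftrightarrow> v \<in> H1_space a b \<and> pw_affine a b M v \<and> (\<forall>x. x \<notin> {a..b} \<longrightarrow> v x = 0)"
    by (simp only: Sh_def pw_affine_def mem_Collect_eq)
  then show ?thesis using pw_affine_H1[of v] by blast
qed

lemma Sh_weak_derivative: "v \<in> Sh a b M \<Longrightarrow> weak_derivative a b v (grad v)"
  by (simp add: Sh_iff pw_affine_weak_derivative)

lemma Sh_add:
  assumes "v \<in> Sh a b M" "w \<in> Sh a b M"
  shows "(\<lambda>x. r * v x + s * w x) \<in> Sh a b M"
proof -
  have "pw_affine a b M (\<lambda>x. r * v x + s * w x)"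
    unfolding pw_affine_def
  proof (intro allI impI)
    fix i assume "i < M"
    then obtain p q p' q' where
      "\<forall>x\<in>{node a b M i..node a b M (Suc i)}. v x = p * x + q"
      "\<forall>x\<in>{node a b M i..node a b M (Suc i)}. w x = p' * x + q'"
      using assms unfolding Sh_iff pw_affine_def by blast
    then show "\<exists>p q. \<forall>x\<in>{node a b M i..node a b M (Suc i)}. r * v x + s * w x = p * x + q"
      by (intro exI[of _ "r * p + s * p'"] exI[of _ "r * q + s * q'"]) (auto simp: algebra_simps)
  qed
  then show ?thesis using assms by (simp add: Sh_iff)
qed

lemma Sh_eqI:
  assumes "v \<in> Sh a b M" "w \<in> Sh a b M" "\<forall>i\<le>M. v (node a b M i) = w (node a b M i)"
  shows "v = w"
proof
  fix x
  show "v x = w x"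
  proof (cases "x \<in> {a..b}")
    case True
    then obtain i where i: "i < M" "x \<in> {node a b M i..node a b M (Suc i)}"
      using cell_exists by blast
    let ?s = "node a b M i" and ?t = "node a b M (Suc i)"
    obtain p q p' q' where pq:
      "\<forall>x\<in>{?s..?t}. v x = p * x + q" "\<forall>x\<in>{?s..?t}. w x = p' * x + q'"
      using assms i unfolding Sh_iff pw_affine_def by blast
    have st: "?s < ?t" by (simp add: node_less_iff)
    have e: "p * ?s + q = p' * ?s + q'" "p * ?t + q = p' * ?t + q'"
      using pq assms(3) i(1) st by (metis atLeastAtMost_iff less_imp_le order_refl Suc_leI)+
    then have "(p - p') * (?t - ?s) = 0" by (simp add: algebra_simps)
    then have "p = p'" using st by simp
    then show ?thesis using e pq i by auto
  qed (use assms in \<open>auto simp: Sh_iff\<close>)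
qed

lemma Sh_exists:
  obtains v where "v \<in> Sh a b M" "\<forall>i\<le>M. v (node a b M i) = c i"
proof -
  define h where "h = (b - a) / real M"
  have h: "h > 0" using ab M by (simp add: h_def)
  have nd: "node a b M i = a + real i * h" for i by (simp add: node_def h_def)
  define i where "i x = (if x = b then M - 1 else nat \<lfloor>(x - a) / h\<rfloor>)" for x
  define L where "L j x = c j + (c (Suc j) - c j) * ((x - (a + real j * h)) / h)" for j :: nat and x
  define v where "v x = (if x \<in> {a..b} then L (i x) x else 0)" for x
  have bM: "b = a + real M * h" using M by (simp add: h_def)
  have val: "v x = L j x" if "j < M" "x \<in> {node a b M j..node a b M (Suc j)}" for j x
  proof -
    have xin: "x \<in> {a..b}" using that cells_Union by blast
    have x: "a + real j * h \<le> x" "x \<le> a + (real j + 1) * h" using that(2) by (auto simp: nd add.commute)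
    show ?thesis
    proof (cases "x = a + (real j + 1) * h")
      case False
      then have lt: "x < a + (real j + 1) * h" using x by simp
      have "(real j + 1) * h \<le> real M * h" using that(1) h by (intro mult_right_mono) auto
      then have "x \<noteq> b" using lt bM by linarith
      moreover have "\<lfloor>(x - a) / h\<rfloor> = int j"
        using x lt h by (intro floor_unique) (auto simp: field_simps)
      ultimately show ?thesis using xin by (simp add: v_def i_def)
    next
      case True
      have Lr: "L j x = c (Suc j)" using h True by (simp add: L_def algebra_simps)
      show ?thesis
      proof (cases "Suc j = M")
        case True
        then have "x = b" using \<open>x = a + (real j + 1) * h\<close> bM by (metis of_nat_Suc add.commute)
        then have "i x = j" using True by (simp add: i_def)
        then show ?thesis using xin by (simp add: v_def)
      next
        case False
        then have "real (Suc j) < real M" using that(1) by simp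
        then have "real (Suc j) * h < real M * h" using h by (intro mult_strict_right_mono)
        then have "x < b" using True bM by (simp add: add.commute)
        then have "x \<noteq> b" by simp
        moreover have "(x - a) / h = real (Suc j)" using True h by (simp add: field_simps)
        ultimately have "i x = Suc j" unfolding i_def by (metis floor_of_nat nat_int)
        then have "v x = L (Suc j) x" using xin by (simp add: v_def)
        also have "\<dots> = c (Suc j)" using True by (simp add: L_def algebra_simps)
        finally show ?thesis using Lr by simp
      qed
    qed
  qed
  have "pw_affine a b M v" unfolding pw_affine_def
  proof (intro allI impI)
    fix j assume j: "j < M"
    show "\<exists>p q. \<forall>x\<in>{node a b M j..node a b M (Suc j)}. v x = p * x + q"
    proof (rule exI[of _ "(c (Suc j) - c j) / h"], rule exI, rule ballI)
      fix x assume "x \<in> {node a b M j..node a b M (Suc j)}"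
      then have "v x = c j + (c (Suc j) - c j) * ((x - (a + real j * h)) / h)"
        using val[OF j] by (simp add: L_def)
      also have "\<dots> = (c (Suc j) - c j) / h * x + (c j - (c (Suc j) - c j) / h * (a + real j * h))"
        using h by (simp add: field_simps)
      finally show "v x = (c (Suc j) - c j) / h * x + (c j - (c (Suc j) - c j) / h * (a + real j * h))" .
    qed
  qed
  then have "v \<in> Sh a b M" by (auto simp: Sh_iff v_def)
  moreover have "v (node a b M j) = c j" if le: "j \<le> M" for j
  proof (cases "j < M")
    case True
    then have "v (node a b M j) = L j (node a b M j)"
      by (intro val) (auto simp: node_le_iff)
    then show ?thesis by (simp add: L_def nd)
  next
    case False
    then obtain j' where j': "j = Suc j'" "j' < M" using False le M by (cases j) auto
    then have "v (node a b M j) = L j' (node a b M j)"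
      by (intro val) (auto simp: node_le_iff)
    then show ?thesis using h j' by (simp add: L_def nd algebra_simps)
  qed
  ultimately show thesis using that by blast
qed

lemma interp_ex1: "\<exists>!v. v \<in> Sh a b M \<and> (\<forall>i\<le>M. v (node a b M i) = g (node a b M i))"
proof -
  obtain v where "v \<in> Sh a b M" "\<forall>i\<le>M. v (node a b M i) = g (node a b M i)"
    using Sh_exists[of "\<lambda>i. g (node a b M i)"] by blast
  then show ?thesis using Sh_eqI by (metis (no_types, lifting))
qed

lemma interp_in_Sh: "interp a b M g \<in> Sh a b M"
  and interp_node: "i \<le> M \<Longrightarrow> interp a b M g (node a b M i) = g (node a b M i)"
  using theI'[OF interp_ex1[of g]] unfolding interp_def by auto

lemma Sh_grad_integrable:
  assumes "v \<in> Sh a b M" "w \<in> Sh a b M"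
  shows "integrable (lebesgue_on {a..b}) (\<lambda>x. grad v x * grad w x)"
  using assms by (intro integrable_bounded_mult_continuous pw_affine_deriv_measurable
      pw_affine_deriv_bounded) (auto simp: Sh_iff)

lemma L2_inner_grad_add:
  assumes "v \<in> Sh a b M" "w \<in> Sh a b M" "w' \<in> Sh a b M"
  shows "L2_inner a b (grad v) (grad (\<lambda>x. r * w x + s * w' x)) =
    r * L2_inner a b (grad v) (grad w) + s * L2_inner a b (grad v) (grad w')"
proof -
  let ?S = "node a b M ` {..M}" and ?w = "\<lambda>x. r * w x + s * w' x"
  have d: "grad v x * grad ?w x = r * (grad v x * grad w x) + s * (grad v x * grad w' x)"
    if "x \<in> {a..b}" "x \<notin> ?S" for x
  proof -
    have "(w has_real_derivative grad w x) (at x)" "(w' has_real_derivative grad w' x) (at x)"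
      using assms that pw_affine_deriv_at by (auto simp: Sh_iff)
    then have "(?w has_real_derivative r * grad w x + s * grad w' x) (at x)"
      by (auto intro!: derivative_eq_intros)
    then show ?thesis by (simp add: DERIV_imp_deriv algebra_simps)
  qed
  note i = Sh_grad_integrable[OF assms(1) Sh_add[OF assms(2,3), of r s]]
    Sh_grad_integrable[OF assms(1,2)] Sh_grad_integrable[OF assms(1,3)]
  have "L2_inner a b (grad v) (grad ?w) =
      (LINT x|lebesgue_on {a..b}. r * (grad v x * grad w x) + s * (grad v x * grad w' x))"
    unfolding L2_inner_def
  proof (rule integral_cong_AE)
    have "negligible ?S" by (intro negligible_finite) simp
    then have "AE x in lebesgue. x \<notin> ?S"
      by (metis AE_not_in negligible_iff_null_sets)
    then show "AE x in lebesgue_on {a..b}. grad v x * grad ?w x =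
        r * (grad v x * grad w x) + s * (grad v x * grad w' x)"
      by (subst AE_restrict_space_iff) (auto elim!: eventually_mono intro: d)
  qed (use i in auto)
  also have "\<dots> = r * L2_inner a b (grad v) (grad w) + s * L2_inner a b (grad v) (grad w')"
    using i by (simp add: L2_inner_def)
  finally show ?thesis .
qed

definition lumped_mass :: "nat \<Rightarrow> real" where
  "lumped_mass i = (b - a) / real M * (if i = 0 \<or> i = M then 1/2 else 1)"

lemma lumped_mass_pos: "lumped_mass i > 0" using ab M by (simp add: lumped_mass_def)

lemma lumped_inner_mass:
  "lumped_inner a b M f g = (\<Sum>i\<le>M. lumped_mass i * (f (node a b M i) * g (node a b M i)))"
proof -
  define h where "h = (b - a) / real M"
  define t where "t i = f (node a b M i) * g (node a b M i)" for i
  obtain n where n: "M = Suc n" using M by (cases M) auto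
  have "lumped_inner a b M f g = (\<Sum>i=1..Suc n. h/2 * (t (i - 1) + t i))"
    unfolding lumped_inner_def by (simp add: h_def t_def n)
  also have "\<dots> = (\<Sum>i\<le>n. h/2 * (t i + t (Suc i)))"
    by (rule sum.reindex_bij_witness[where i=Suc and j="\<lambda>i. i - 1"]) auto
  also have "\<dots> = (\<Sum>i\<le>n. h/2 * t i) + (\<Sum>i\<le>n. h/2 * t (Suc i))"
    by (simp add: sum.distrib distrib_left)
  also have "\<dots> = (h/2 * t 0 + (\<Sum>i=1..n. h/2 * t i)) + ((\<Sum>i=1..n. h/2 * t i) + h/2 * t (Suc n))"
  proof -
    have "(\<Sum>i\<le>n. h/2 * t i) = h/2 * t 0 + (\<Sum>i=1..n. h/2 * t i)"
      by (simp add: atMost_atLeast0 sum.atLeast_Suc_atMost)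
    moreover have "(\<Sum>i\<le>n. h/2 * t (Suc i)) = (\<Sum>i=1..Suc n. h/2 * t i)"
      by (rule sum.reindex_bij_witness[where j=Suc and i="\<lambda>i. i - 1"]) auto
    ultimately show ?thesis by simp
  qed
  also have "\<dots> = h/2 * t 0 + (\<Sum>i=1..n. h * t i) + h/2 * t (Suc n)"
  proof -
    have "(\<Sum>i=1..n. h * t i) = 2 * (\<Sum>i=1..n. h/2 * t i)" by (simp add: sum_distrib_left)
    then show ?thesis by simp
  qed
  also have "\<dots> = (\<Sum>i\<le>Suc n. lumped_mass i * t i)"
  proof -
    have "(\<Sum>i\<le>Suc n. lumped_mass i * t i) = lumped_mass 0 * t 0 + (\<Sum>i=1..n. lumped_mass i * t i) + lumped_mass (Suc n) * t (Suc n)"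
      by (simp add: atMost_atLeast0 sum.atLeast_Suc_atMost)
    moreover have "(\<Sum>i=1..n. lumped_mass i * t i) = (\<Sum>i=1..n. h * t i)"
    proof (rule sum.cong)
      fix i assume "i \<in> {1..n}"
      then have "i \<noteq> 0" "i \<noteq> M" by (auto simp: n)
      then have "lumped_mass i = h" by (simp add: lumped_mass_def h_def)
      then show "lumped_mass i * t i = h * t i" by simp
    qed simp
    moreover have "lumped_mass 0 = h/2" "lumped_mass (Suc n) = h/2"
      by (simp_all add: lumped_mass_def h_def n[symmetric])
    ultimately show ?thesis by simp
  qed
  finally show ?thesis by (simp add: t_def n)
qed

lemma L2_inner_grad_nodal:
  assumes v: "v \<in> Sh a b M"
  obtains l where "\<And>w. w \<in> Sh a b M \<Longrightarrow>
    L2_inner a b (grad v) (grad w) = (\<Sum>i\<le>M. l i * w (node a b M i))"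
proof -
  define hat where "hat i = interp a b M (\<lambda>x. if x = node a b M i then 1 else 0)" for i
  have hat: "hat i \<in> Sh a b M" for i by (simp add: hat_def interp_in_Sh)
  have nd: "node a b M j = node a b M i \<longleftrightarrow> j = i" for i j
    by (metis node_less_iff less_irrefl linorder_neqE_nat)
  have hatn: "hat i (node a b M j) = (if j = i then 1 else 0)" if "j \<le> M" for i j
    using that by (simp add: hat_def interp_node nd)
  define l where "l i = L2_inner a b (grad v) (grad (hat i))" for i
  show thesis
  proof (rule that)
    fix w assume w: "w \<in> Sh a b M"
    have z: "(\<lambda>x. 0) \<in> Sh a b M" using Sh_add[OF w w, of 0 0] by simp
    have comb: "(\<lambda>x. \<Sum>i<n. w (node a b M i) * hat i x) \<in> Sh a b M \<and>
      L2_inner a b (grad v) (grad (\<lambda>x. \<Sum>i<n. w (node a b M i) * hat i x)) =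
        (\<Sum>i<n. w (node a b M i) * l i)" for n
    proof (induction n)
      case 0
      then show ?case using z by (simp add: L2_inner_def)
    next
      case (Suc n)
      show ?case
        using Sh_add[OF conjunct1[OF Suc] hat[of n], of 1 "w (node a b M n)"]
          L2_inner_grad_add[OF v conjunct1[OF Suc] hat[of n], of 1 "w (node a b M n)"] Suc
        by (simp add: l_def)
    qed
    have "w = (\<lambda>x. \<Sum>i<Suc M. w (node a b M i) * hat i x)"
    proof (rule Sh_eqI[OF w conjunct1[OF comb]], intro allI impI)
      fix j assume j: "j \<le> M"
      have "(\<Sum>i<Suc M. w (node a b M i) * hat i (node a b M j)) =
          (\<Sum>i<Suc M. if i = j then w (node a b M j) else 0)"
        using hatn[OF j] by (intro sum.cong) auto
      also have "\<dots> = w (node a b M j)" using j by (subst sum.delta) auto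
      finally show "w (node a b M j) = (\<Sum>i<Suc M. w (node a b M i) * hat i (node a b M j))" by simp
    qed
    then have "L2_inner a b (grad v) (grad w) = (\<Sum>i<Suc M. w (node a b M i) * l i)"
      using comb[of "Suc M"] by simp
    then show "L2_inner a b (grad v) (grad w) = (\<Sum>i\<le>M. l i * w (node a b M i))"
      by (simp add: lessThan_Suc_atMost mult.commute)
  qed
qed

lemma disc_laplacian_ex1:
  assumes v: "v \<in> Sh a b M"
  shows "\<exists>!q. q \<in> Sh a b M \<and>
     (\<forall>w\<in>Sh a b M. lumped_inner a b M (\<lambda>x. - q x) w = L2_inner a b (grad v) (grad w))"
proof -
  obtain l where l: "\<And>w. w \<in> Sh a b M \<Longrightarrow>
    L2_inner a b (grad v) (grad w) = (\<Sum>i\<le>M. l i * w (node a b M i))"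
    by (rule L2_inner_grad_nodal[OF v]) blast
  obtain q where q: "q \<in> Sh a b M" "\<forall>i\<le>M. q (node a b M i) = - l i / lumped_mass i"
    by (rule Sh_exists[of "\<lambda>i. - l i / lumped_mass i"]) blast
  have ex: "lumped_inner a b M (\<lambda>x. - q x) w = L2_inner a b (grad v) (grad w)"
    if "w \<in> Sh a b M" for w
    unfolding lumped_inner_mass l[OF that]
  proof (rule sum.cong)
    fix i assume "i \<in> {..M}"
    then show "lumped_mass i * (- q (node a b M i) * w (node a b M i)) = l i * w (node a b M i)"
      using q(2) lumped_mass_pos[of i] by simp
  qed simp
  show ?thesis
  proof (rule ex1I[of _ q])
    show "q \<in> Sh a b M \<and>
     (\<forall>w\<in>Sh a b M. lumped_inner a b M (\<lambda>x. - q x) w = L2_inner a b (grad v) (grad w))"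
      using q(1) ex by blast
    fix r assume r: "r \<in> Sh a b M \<and>
     (\<forall>w\<in>Sh a b M. lumped_inner a b M (\<lambda>x. - r x) w = L2_inner a b (grad v) (grad w))"
    define w where "w x = 1 * r x + (- 1) * q x" for x
    have w: "w \<in> Sh a b M" unfolding w_def using r q(1) by (intro Sh_add) auto
    have "lumped_inner a b M (\<lambda>x. - r x) w = lumped_inner a b M (\<lambda>x. - q x) w"
      using r ex[OF w] w by simp
    then have "(\<Sum>i\<le>M. lumped_mass i * (- r (node a b M i) * w (node a b M i))) =
        (\<Sum>i\<le>M. lumped_mass i * (- q (node a b M i) * w (node a b M i)))"
      by (simp add: lumped_inner_mass)
    moreover have "(\<Sum>i\<le>M. lumped_mass i * (w (node a b M i))\<^sup>2) =
        (\<Sum>i\<le>M. lumped_mass i * (- q (node a b M i) * w (node a b M i))) -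
        (\<Sum>i\<le>M. lumped_mass i * (- r (node a b M i) * w (node a b M i)))"
      unfolding sum_subtractf[symmetric]
      by (rule sum.cong) (simp_all add: w_def power2_eq_square algebra_simps)
    ultimately have z: "(\<Sum>i\<le>M. lumped_mass i * (w (node a b M i))\<^sup>2) = 0" by simp
    have "w (node a b M i) = 0" if "i \<le> M" for i
    proof -
      have "lumped_mass i * (w (node a b M i))\<^sup>2 = 0"
        using z that by (subst (asm) sum_nonneg_eq_0_iff) (auto simp: lumped_mass_pos less_imp_le)
      then show ?thesis using lumped_mass_pos[of i] by simp
    qed
    then show "r = q" using r q(1) by (intro Sh_eqI) (auto simp: w_def)
  qed
qed

lemma disc_laplacian_in_Sh: "v \<in> Sh a b M \<Longrightarrow> disc_laplacian a b M v \<in> Sh a b M"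
  and disc_laplacian_eq: "v \<in> Sh a b M \<Longrightarrow> w \<in> Sh a b M \<Longrightarrow>
    lumped_inner a b M (\<lambda>x. - disc_laplacian a b M v x) w = L2_inner a b (grad v) (grad w)"
  using theI'[OF disc_laplacian_ex1[of v]] unfolding disc_laplacian_def by auto

end

lemma lagrange_time_delta:
  assumes "\<tau> \<noteq> 0" "k \<le> n" "l \<in> {1..k}" "i \<in> {1..k}"
  shows "lagrange_time \<tau> k n l (real (n - i) * \<tau>) = (if i = l then 1 else 0)"
proof (cases "i = l")
  case True
  have "lagrange_time \<tau> k n l (real (n - i) * \<tau>) = (\<Prod>j\<in>{1..k} - {l}. 1)"
    unfolding lagrange_time_def using assms True by (intro prod.cong) auto
  then show ?thesis using True by simp
next
  case False
  have "lagrange_time \<tau> k n l (real (n - i) * \<tau>) = 0"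
    unfolding lagrange_time_def using assms False by (intro prod_zero) auto
  then show ?thesis using False by simp
qed

end

theory Submission
  imports Defs
begin

text \<open>For piecewise linear functions the form $(\nabla v,\nabla w)$ is $h^{-1}$ times the Euclidean
  inner product of the vectors of nodal increments. The cut-off is 1-Lipschitz at every node, so it
  does not enlarge any increment, hence not $\|\nabla\hat u_h^n\|$ either. Algebraic stability, used
  for each increment and for $z$ separately, bounds the energy before the cut-off by the old energy
  plus $\tau\sum_i b_i\big((\nabla u_h^{ni},\nabla\dot u_h^{ni})+2z^{ni}\dot z^{ni}\big)$. The
  equations for the stages turn the bracket into $-(\dot u_h^{ni},\dot u_h^{ni})_h$.\<close>

text \<open>The two transposed halves of the matrix give the same double sum after exchanging the
  order of summation, hence the factor 2; the rank-one part \<open>bs $ i * bs $ j\<close> gives the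
  square.\<close>

lemma inner_stability_matrix:
  fixes A :: "real^'m^'m" and bs d :: "real^'m"
  shows "d \<bullet> (stability_matrix A bs *v d) =
    2 * (\<Sum>i\<in>UNIV. bs $ i * d $ i * (\<Sum>j\<in>UNIV. A $ i $ j * d $ j)) - (\<Sum>i\<in>UNIV. bs $ i * d $ i)\<^sup>2"
proof -
  let ?t = "\<lambda>i j. bs $ i * d $ i * (A $ i $ j * d $ j)"
  have "d \<bullet> (stability_matrix A bs *v d) =
      (\<Sum>i\<in>UNIV. \<Sum>j\<in>UNIV. ?t i j + ?t j i - bs $ i * d $ i * (bs $ j * d $ j))"
    by (auto simp: inner_vec_def matrix_vector_mult_def stability_matrix_def sum_distrib_left
        algebra_simps intro!: sum.cong)
  also have "\<dots> = (\<Sum>i\<in>UNIV. \<Sum>j\<in>UNIV. ?t i j) + (\<Sum>i\<in>UNIV. \<Sum>j\<in>UNIV. ?t j i) -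
      (\<Sum>i\<in>UNIV. \<Sum>j\<in>UNIV. bs $ i * d $ i * (bs $ j * d $ j))"
    by (simp only: sum.distrib sum_subtractf)
  also have "(\<Sum>i\<in>UNIV. \<Sum>j\<in>UNIV. ?t j i) = (\<Sum>i\<in>UNIV. \<Sum>j\<in>UNIV. ?t i j)"
    by (rule sum.swap)
  finally show ?thesis
    by (simp add: power2_eq_square sum_product) (simp add: sum_distrib_left mult.assoc)
qed

text \<open>Scalar form of algebraic stability. Expanding \<open>x1\<close> around \<open>x0\<close>
  and replacing \<open>x0\<close> by the stages \<open>X i\<close> in the mixed term leaves as
  defect exactly -\<tau>^2 times the quadratic form of the stability matrix at \<open>d\<close>,
  which is at most 0.\<close>

lemma algebraically_stable_rk_bound:
  fixes A :: "real^'m^'m" and bs :: "real^'m" and d X :: "'m \<Rightarrow> real"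
  assumes stab: "algebraically_stable A bs"
    and X: "\<And>i. X i = x0 + \<tau> * (\<Sum>j\<in>UNIV. A $ i $ j * d j)"
    and x1: "x1 = x0 + \<tau> * (\<Sum>i\<in>UNIV. bs $ i * d i)"
  shows "x1\<^sup>2 \<le> x0\<^sup>2 + 2 * \<tau> * (\<Sum>i\<in>UNIV. bs $ i * (X i * d i))"
proof -
  define S where "S = (\<Sum>i\<in>UNIV. bs $ i * d i)"
  define R where "R = (\<Sum>i\<in>UNIV. bs $ i * d i * (\<Sum>j\<in>UNIV. A $ i $ j * d j))"
  have "0 \<le> (\<chi> i. d i) \<bullet> (stability_matrix A bs *v (\<chi> i. d i))"
    using stab by (simp add: algebraically_stable_def pos_semidef_def)
  then have "0 \<le> 2 * R - S\<^sup>2" by (simp add: inner_stability_matrix S_def R_def)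
  then have "0 \<le> \<tau>\<^sup>2 * (2 * R - S\<^sup>2)" by simp
  moreover have "(\<Sum>i\<in>UNIV. bs $ i * (X i * d i)) = x0 * S + \<tau> * R"
    by (simp add: X S_def R_def sum_distrib_left sum.distrib algebra_simps)
  moreover have "x1 = x0 + \<tau> * S" by (simp add: x1 S_def)
  ultimately show ?thesis by (simp add: power2_eq_square algebra_simps)
qed

definition nodal_diff :: "real \<Rightarrow> real \<Rightarrow> nat \<Rightarrow> (real \<Rightarrow> real) \<Rightarrow> nat \<Rightarrow> real" where
  "nodal_diff a b M v j = v (node a b M (Suc j)) - v (node a b M j)"

context
  fixes a b :: real and M :: nat
  assumes ab: "a < b" and M: "1 \<le> M"
begin

text \<open>On a cell of length h both gradients are constant, equal to increment over h, so the
  cell contributes the product of the increments divided by h.\<close>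

lemma L2_inner_grad_eq_nodal_diff:
  assumes v: "v \<in> Sh a b M" and w: "w \<in> Sh a b M"
  shows "L2_inner a b (grad v) (grad w) =
    (\<Sum>j<M. nodal_diff a b M v j * nodal_diff a b M w j) / ((b - a) / real M)"
proof -
  define h where "h = (b - a) / real M"
  have h: "0 < h" using ab M by (simp add: h_def)
  have nd: "node a b M (Suc j) = node a b M j + h" for j
    by (simp add: node_def h_def distrib_right add_divide_distrib)
  have grad: "grad f x = nodal_diff a b M f j / h"
    if f: "f \<in> Sh a b M" and j: "j < M" and x: "x \<in> {node a b M j<..<node a b M (Suc j)}" for f j x
  proof -
    obtain p q where pq: "\<forall>x\<in>{node a b M j..node a b M (Suc j)}. f x = p * x + q"
      using f j unfolding Sh_def by blast
    have "((\<lambda>x. p * x + q) has_real_derivative p) (at x)"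
      by (auto intro!: derivative_eq_intros)
    then have "(f has_real_derivative p) (at x)"
      by (rule has_field_derivative_transform_within_open[where
          S="{node a b M j<..<node a b M (Suc j)}"]) (use x pq in auto)
    moreover have "nodal_diff a b M f j = p * h"
      using pq h by (simp add: nodal_diff_def nd algebra_simps)
    ultimately show ?thesis using h by (simp add: DERIV_imp_deriv)
  qed
  \<comment> \<open>The derivative is known only inside the cell, since \<open>v\<close> and
    \<open>w\<close> may have kinks at the nodes; the two endpoints are therefore discarded as a
    finite exceptional set.\<close>
  have cell: "((\<lambda>x. grad v x * grad w x) has_integral
      nodal_diff a b M v j * nodal_diff a b M w j / h) {node a b M j..node a b M (Suc j)}"
    if j: "j < M" for j
  proof (rule has_integral_spike_finite[where S="{node a b M j, node a b M (Suc j)}"])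
    let ?c = "nodal_diff a b M v j / h * (nodal_diff a b M w j / h)"
    have "((\<lambda>x. ?c) has_integral (node a b M (Suc j) - node a b M j) *\<^sub>R ?c)
        {node a b M j..node a b M (Suc j)}"
      by (rule has_integral_const_real[THEN has_integral_eq_rhs]) (use h nd in simp)
    then show "((\<lambda>x. ?c) has_integral nodal_diff a b M v j * nodal_diff a b M w j / h)
        {node a b M j..node a b M (Suc j)}"
      using h by (simp add: nd)
  qed (use grad[OF v j] grad[OF w j] in auto)
  \<comment> \<open>Cells are glued from the left, starting from the degenerate interval at
    \<open>a\<close>.\<close>
  have "((\<lambda>x. grad v x * grad w x) has_integral
      (\<Sum>j<n. nodal_diff a b M v j * nodal_diff a b M w j / h)) {a..node a b M n}" if "n \<le> M" for n
    using that
  proof (induction n)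
    case 0
    then show ?case by (simp add: node_0[OF ab M] has_integral_refl(2)[of _ a, unfolded box_real])
  next
    case (Suc n)
    show ?case
      unfolding sum.lessThan_Suc
    proof (rule has_integral_combine)
      show "a \<le> node a b M n" "node a b M n \<le> node a b M (Suc n)"
        using node_in[OF ab M, of n] Suc.prems h nd by auto
    qed (use Suc cell in auto)
  qed
  from this[of M] have "integral {a..b} (\<lambda>x. grad v x * grad w x) =
      (\<Sum>j<M. nodal_diff a b M v j * nodal_diff a b M w j / h)"
    by (simp add: node_M[OF ab M] integral_unique)
  moreover have "L2_inner a b (grad v) (grad w) = integral {a..b} (\<lambda>x. grad v x * grad w x)"
    unfolding L2_inner_def
    by (intro lebesgue_integral_eq_integral Sh_grad_integrable[OF ab M v w]) simp
  ultimately show ?thesis by (simp only: h_def sum_divide_distrib)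
qed

lemma L2_norm_grad_eq_nodal_diff:
  assumes "v \<in> Sh a b M"
  shows "(L2_norm a b (grad v))\<^sup>2 = (\<Sum>j<M. (nodal_diff a b M v j)\<^sup>2) / ((b - a) / real M)"
proof -
  have "L2_inner a b (grad v) (grad v) = (\<Sum>j<M. (nodal_diff a b M v j)\<^sup>2) / ((b - a) / real M)"
    by (simp add: L2_inner_grad_eq_nodal_diff[OF assms assms] power2_eq_square)
  \<comment> \<open>Squaring undoes the \<open>sqrt\<close> in \<open>L2_norm\<close> only for a
    nonnegative argument.\<close>
  moreover have "0 \<le> (\<Sum>j<M. (nodal_diff a b M v j)\<^sup>2) / ((b - a) / real M)"
    using ab by (intro divide_nonneg_nonneg sum_nonneg) auto
  ultimately show ?thesis by (simp only: L2_norm_def real_sqrt_pow2)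
qed

text \<open>Since the gradient norm depends on nodal increments alone, comparing neighbouring nodal
  values before and after clipping is enough.\<close>

lemma L2_norm_grad_cutoff_le:
  assumes v: "v \<in> Sh a b M" and w: "w \<in> Sh a b M"
    and cut: "\<And>j. j \<le> M \<Longrightarrow> w (node a b M j) = min (max (v (node a b M j)) (- \<alpha>)) \<alpha>"
  shows "(L2_norm a b (grad w))\<^sup>2 \<le> (L2_norm a b (grad v))\<^sup>2"
proof -
  have "(nodal_diff a b M w j)\<^sup>2 \<le> (nodal_diff a b M v j)\<^sup>2" if "j < M" for j
  proof -
    have "\<bar>nodal_diff a b M w j\<bar> \<le> \<bar>nodal_diff a b M v j\<bar>"
      using that by (auto simp: nodal_diff_def cut min_def max_def)
    then show ?thesis by (simp add: abs_le_square_iff)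
  qed
  then show ?thesis
    unfolding L2_norm_grad_eq_nodal_diff[OF v] L2_norm_grad_eq_nodal_diff[OF w]
    using ab by (intro divide_right_mono sum_mono) auto
qed

text \<open>An affine function on a cell lies between its endpoint values. This carries the bound
  enforced at the nodes over to all of the interval.\<close>

lemma Sh_abs_le:
  assumes v: "v \<in> Sh a b M" and le: "\<And>j. j \<le> M \<Longrightarrow> \<bar>v (node a b M j)\<bar> \<le> \<alpha>" and x: "x \<in> {a..b}"
  shows "\<bar>v x\<bar> \<le> \<alpha>"
proof -
  obtain j where j: "j < M" "x \<in> {node a b M j..node a b M (Suc j)}"
    using cell_exists[OF ab M x] by blast
  obtain p q where pq: "\<forall>x\<in>{node a b M j..node a b M (Suc j)}. v x = p * x + q"
    using v j(1) unfolding Sh_def by blast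
  have "\<bar>p * node a b M j + q\<bar> \<le> \<alpha>" "\<bar>p * node a b M (Suc j) + q\<bar> \<le> \<alpha>"
    using le[of j] le[of "Suc j"] j pq by auto
  \<comment> \<open>Which endpoint gives the upper bound depends on the sign of the slope
    \<open>p\<close>.\<close>
  moreover have "(p * node a b M j \<le> p * x \<and> p * x \<le> p * node a b M (Suc j)) \<or>
      (p * node a b M (Suc j) \<le> p * x \<and> p * x \<le> p * node a b M j)"
    using j(2) by (cases "0 \<le> p") (auto intro: mult_left_mono mult_left_mono_neg)
  ultimately show ?thesis using j(2) pq by auto
qed

lemma lumped_inner_nonneg: "0 \<le> lumped_inner a b M v v"
  using ab unfolding lumped_inner_def by (intro sum_nonneg mult_nonneg_nonneg) auto

text \<open>Testing the stage equation with \<open>dU\<close> in the lumped product: the discrete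
  Laplacian turns the gradient form into the product of \<open>Z * f - dU\<close> with
  \<open>dU\<close>, and the term -(dU,dU)_h is dropped by its sign.\<close>

lemma grad_stage_dissipation:
  assumes U: "U \<in> Sh a b M" and dU: "dU \<in> Sh a b M"
    and eq: "\<And>x. dU x = disc_laplacian a b M U x + Z * f x"
  shows "L2_inner a b (grad U) (grad dU) \<le> Z * lumped_inner a b M f dU"
proof -
  have "L2_inner a b (grad U) (grad dU) = lumped_inner a b M (\<lambda>x. Z * f x - dU x) dU"
    unfolding disc_laplacian_eq[OF ab M U dU, symmetric] eq by simp
  also have "\<dots> = Z * lumped_inner a b M f dU - lumped_inner a b M dU dU"
    unfolding lumped_inner_def sum_distrib_left sum_subtractf[symmetric]
    by (intro sum.cong) (auto simp: algebra_simps)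
  finally show ?thesis using lumped_inner_nonneg[of dU] by simp
qed

text \<open>Nodal increments are linear in the function, so on each cell they obey the same
  Runge--Kutta relations and the scalar bound applies; summing over the cells and dividing by the
  mesh size restores the gradient forms.\<close>

lemma L2_norm_grad_rk_bound:
  fixes A :: "real^'m^'m" and bs :: "real^'m" and U dU :: "'m \<Rightarrow> real \<Rightarrow> real"
  assumes stab: "algebraically_stable A bs"
    and Sh: "\<And>i. U i \<in> Sh a b M" "\<And>i. dU i \<in> Sh a b M" "u0 \<in> Sh a b M" "u1 \<in> Sh a b M"
    and U: "\<And>i x. U i x = u0 x + \<tau> * (\<Sum>j\<in>UNIV. A $ i $ j * dU j x)"
    and u1: "\<And>x. u1 x = u0 x + \<tau> * (\<Sum>i\<in>UNIV. bs $ i * dU i x)"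
  shows "(L2_norm a b (grad u1))\<^sup>2 \<le> (L2_norm a b (grad u0))\<^sup>2 +
    2 * \<tau> * (\<Sum>i\<in>UNIV. bs $ i * L2_inner a b (grad (U i)) (grad (dU i)))"
proof -
  let ?D = "nodal_diff a b M"
  have "(\<Sum>j<M. (?D u1 j)\<^sup>2) \<le>
      (\<Sum>j<M. (?D u0 j)\<^sup>2 + 2 * \<tau> * (\<Sum>i\<in>UNIV. bs $ i * (?D (U i) j * ?D (dU i) j)))"
    by (intro sum_mono algebraically_stable_rk_bound[OF stab])
      (simp_all add: nodal_diff_def U u1 right_diff_distrib sum_subtractf)
  also have "\<dots> = (\<Sum>j<M. (?D u0 j)\<^sup>2) +
      2 * \<tau> * (\<Sum>i\<in>UNIV. bs $ i * (\<Sum>j<M. ?D (U i) j * ?D (dU i) j))"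
    unfolding sum.distrib sum_distrib_left by (subst sum.swap) simp
  finally have "(\<Sum>j<M. (?D u1 j)\<^sup>2) / ((b - a) / real M) \<le> \<dots> / ((b - a) / real M)"
    using ab by (intro divide_right_mono) auto
  then show ?thesis
    by (simp only: L2_norm_grad_eq_nodal_diff Sh L2_inner_grad_eq_nodal_diff add_divide_distrib
        times_divide_eq_right[symmetric] sum_divide_distrib)
qed

lemma cutoff_sav_rk_step_Sh:
  assumes "cutoff_sav_rk_step a b M F C0 \<alpha> \<tau> k A bs cs u z n"
  shows "u n \<in> Sh a b M"
  using assms by (auto simp: cutoff_sav_rk_step_def)

lemma cutoff_sav_rk_step_abs_le:
  assumes "cutoff_sav_rk_step a b M F C0 \<alpha> \<tau> k A bs cs u z n" and "0 < \<alpha>" and "x \<in> {a..b}"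
  shows "\<bar>u n x\<bar> \<le> \<alpha>"
proof (rule Sh_abs_le[OF cutoff_sav_rk_step_Sh[OF assms(1)] _ assms(3)])
  fix j assume "j \<le> M"
  then obtain y where "u n (node a b M j) = min (max y (- \<alpha>)) \<alpha>"
    using assms(1) unfolding cutoff_sav_rk_step_def by blast
  \<comment> \<open>Positivity of \<alpha> gives -\<alpha> < \<alpha>, so the clipped value lies in
    [-\<alpha>, \<alpha>] whatever \<open>y\<close> is.\<close>
  then show "\<bar>u n (node a b M j)\<bar> \<le> \<alpha>" using assms(2) by auto
qed

lemma cutoff_sav_rk_step_energy:
  fixes A :: "real^'m^'m" and bs cs :: "real^'m"
  assumes step: "cutoff_sav_rk_step a b M F C0 \<alpha> \<tau> k A bs cs u z n"
    and stab: "algebraically_stable A bs" and \<tau>: "0 \<le> \<tau>" and u0: "u (n - 1) \<in> Sh a b M"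
  shows "1/2 * (L2_norm a b (grad (u n)))\<^sup>2 + \<bar>z n\<bar>\<^sup>2
    \<le> 1/2 * (L2_norm a b (grad (u (n - 1))))\<^sup>2 + \<bar>z (n - 1)\<bar>\<^sup>2"
proof -
  define f :: "'m \<Rightarrow> real \<Rightarrow> real" where "f = extrapolated_W a b M F C0 \<tau> k cs u n"
  obtain U dU :: "'m \<Rightarrow> real \<Rightarrow> real" and Z dZ uhat where
    Sh: "\<forall>i. U i \<in> Sh a b M \<and> dU i \<in> Sh a b M" "uhat \<in> Sh a b M" and
    dU: "\<forall>i x. dU i x = disc_laplacian a b M (U i) x + Z i * f i x" and
    U: "\<forall>i x. U i x = u (n - 1) x + \<tau> * (\<Sum>j\<in>UNIV. A $ i $ j * dU j x)" and
    uhat: "\<forall>x. uhat x = u (n - 1) x + \<tau> * (\<Sum>i\<in>UNIV. bs $ i * dU i x)" and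
    dZ: "\<forall>i. dZ i = - 1/2 * lumped_inner a b M (f i) (dU i)" and
    Z: "\<forall>i. Z i = z (n - 1) + \<tau> * (\<Sum>j\<in>UNIV. A $ i $ j * dZ j)" and
    zn: "z n = z (n - 1) + \<tau> * (\<Sum>i\<in>UNIV. bs $ i * dZ i)" and
    cut: "\<forall>j\<le>M. u n (node a b M j) = min (max (uhat (node a b M j)) (- \<alpha>)) \<alpha>"
    using step unfolding cutoff_sav_rk_step_def f_def[symmetric] by (elim exE conjE) (rule that)
  have SU: "U i \<in> Sh a b M" and SdU: "dU i \<in> Sh a b M" for i using Sh(1) by auto
  let ?G = "\<lambda>i. L2_inner a b (grad (U i)) (grad (dU i))"
  \<comment> \<open>The factor -1/2 in the equation for \<open>dZ\<close> makes Z_i (f_i,dU_i)_h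
    equal to -2 Z_i dZ_i, and positive weights preserve the stagewise estimate.\<close>
  have "(\<Sum>i\<in>UNIV. bs $ i * ?G i) \<le> (\<Sum>i\<in>UNIV. bs $ i * (- 2 * (Z i * dZ i)))"
  proof (intro sum_mono mult_left_mono)
    fix i
    show "?G i \<le> - 2 * (Z i * dZ i)"
      using grad_stage_dissipation[OF SU SdU dU[rule_format]] by (simp add: dZ)
    show "0 \<le> bs $ i" using stab by (simp add: algebraically_stable_def less_imp_le)
  qed
  also have "\<dots> = - 2 * (\<Sum>i\<in>UNIV. bs $ i * (Z i * dZ i))"
    unfolding sum_distrib_left by (intro sum.cong) auto
  finally have "\<tau> * (\<Sum>i\<in>UNIV. bs $ i * ?G i) \<le> \<tau> * \<dots>"
    using \<tau> by (rule mult_left_mono)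
  moreover have "(L2_norm a b (grad (u n)))\<^sup>2 \<le> (L2_norm a b (grad uhat))\<^sup>2"
    by (rule L2_norm_grad_cutoff_le[OF Sh(2) cutoff_sav_rk_step_Sh[OF step] cut[rule_format]])
  moreover note L2_norm_grad_rk_bound[OF stab SU SdU u0 Sh(2) U[rule_format] uhat[rule_format]]
    algebraically_stable_rk_bound[OF stab Z[rule_format] zn]
  \<comment> \<open>Half the gradient bound is added to the bound for \<open>z\<close>: the coupling
    contributes at most -2 \<tau> sum b_i Z_i dZ_i to the former and exactly the opposite amount to
    the latter.\<close>
  ultimately show ?thesis by simp
qed

end

theorem theorem4p2:
  fixes a b T \<tau> \<alpha> C0 :: real and M N p k :: nat
    and F :: "real \<Rightarrow> real"
    and A :: "real^'m^'m" and bs cs :: "real^'m"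
    and u :: "nat \<Rightarrow> real \<Rightarrow> real" and z :: "nat \<Rightarrow> real"
  assumes "a < b" and "0 < T" and "1 \<le> M" and "1 \<le> N" and "\<tau> = T / real N"
    and "0 < \<alpha>" and "double_well F \<alpha>"
    and "\<forall>v. continuous_on {a..b} v \<longrightarrow> - C0 < E1 a b F v"
    and "rk_collocation A bs cs p" and "k = min p (CARD('m) + 1)"
    and "algebraically_stable A bs"
    and "\<forall>n<k. u n \<in> Sh a b M"
    and "\<forall>n\<in>{k..N}. cutoff_sav_rk_step a b M F C0 \<alpha> \<tau> k A bs cs u z n"
  shows "(\<forall>n\<in>{k..N}. 1/2 * (L2_norm a b (grad (u n)))\<^sup>2 + \<bar>z n\<bar>\<^sup>2
            \<le> 1/2 * (L2_norm a b (grad (u (n - 1))))\<^sup>2 + \<bar>z (n - 1)\<bar>\<^sup>2) \<and>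
         (\<forall>n\<in>{k..N}. \<forall>x\<in>{a..b}. \<bar>u n x\<bar> \<le> \<alpha>)"
proof -
  have \<tau>: "0 \<le> \<tau>" using assms(2,5) by simp
  \<comment> \<open>The energy estimate needs \<open>u (n - 1)\<close> in \<open>Sh\<close>: this is
    a starting value for indices below \<open>k\<close> and the output of an earlier step
    otherwise.\<close>
  have Sh: "u n \<in> Sh a b M" if "n \<le> N" for n
    using assms(12,13) that by (cases "n < k") (auto intro: cutoff_sav_rk_step_Sh[OF assms(1,3)])
  show ?thesis
  proof (intro conjI ballI)
    fix n assume n: "n \<in> {k..N}"
    show "1/2 * (L2_norm a b (grad (u n)))\<^sup>2 + \<bar>z n\<bar>\<^sup>2
        \<le> 1/2 * (L2_norm a b (grad (u (n - 1))))\<^sup>2 + \<bar>z (n - 1)\<bar>\<^sup>2"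
      by (rule cutoff_sav_rk_step_energy[OF assms(1,3) assms(13)[rule_format, OF n] assms(11) \<tau>])
        (use n Sh in auto)
    show "\<bar>u n x\<bar> \<le> \<alpha>" if "x \<in> {a..b}" for x
      by (rule cutoff_sav_rk_step_abs_le[OF assms(1,3) assms(13)[rule_format, OF n] assms(6) that])
  qed
qed

end
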